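(* Let $G$ be a finite abelian group with chain $1\subset G$, and let $\Omega\supset M\supset M_1\supset0\supset\cdots$ be an $F\mathbb{C}G$-glider representation of essential length $1$ and zero body. Then $\Omega\supset M$ is irreducible if and only if $$\langle\chi_M,\chi_M\rangle=\begin{pmatrix}n^2&1\\0&n\end{pmatrix}$$ for some positive integer $n\le|G|$.
   Context: The filtration $F\mathbb{C}G$ is $F_0=\mathbb{C}$, $F_n=\mathbb{C}G$ for $n\ge1$, $F_n=0$ for $n<0$. A glider representation of essential length $1$ and zero body consists of a $\mathbb{C}G$-module $\Omega$ and finite-dimensional $\mathbb{C}$-subspaces $\Omega\supset M=M_0\supset M_1\ne0$, $M_i=0$ for $i\geq 2$, with $\mathbb{C}G\,M_1\subset M$. Such a glider is irreducible if and only if $\dim_{\mathbb{C}}M_1=1$ and $M=\mathbb{C}G\,M_1$; take this as the definition of irreducible. The generalized trace $\chi_M$ has components $\chi_{00}$, $\chi_{01}$ (the characters of the trivial group on the vector spaces $M$ and $M_1$, i.e. the numbers $\dim M$ and $\dim M_1$) and $\chi_{11}$ (the character of the $G$-module $\mathbb{C}G\,M_1$). The generalized inproduct is $$\langle f,g\rangle=\begin{pmatrix}\langle f_{00},g_{00}\rangle^{1}&\langle f_{01},g_{01}\rangle^{1}\\0&\langle f_{11},g_{11}\rangle^{G}\end{pmatrix},$$ where for a finite group $\Gamma$ and class functions $\langle f,g\rangle^{\Gamma}=\frac1{|\Gamma|}\sum_{x\in\Gamma}f(x)g(x^{-1})$. *)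

theory Defs
  imports "HOL-Analysis.Analysis" "HOL-Library.Poly_Mapping"
begin

text \<open>
  The finite abelian group $G$ is a type of class \<open>{finite, ab_group_add}\<close>, written additively.
  Its group algebra over the complex numbers is the ring \<open>'g \<Rightarrow>\<^sub>0 complex\<close>, whose
  multiplication is convolution; the group element \<open>g\<close> is \<open>Poly_Mapping.single g 1\<close> and
  the scalar \<open>c\<close> is \<open>Poly_Mapping.single 0 c\<close>. The module $\Omega$ is the type \<open>'v\<close>
  with the action \<open>smul\<close> of the group algebra.
\<close>

type_synonym 'g group_alg = "'g \<Rightarrow>\<^sub>0 complex"

definition group_alg_filtration :: "int \<Rightarrow> ('g::{finite,ab_group_add}) group_alg set" where
  "group_alg_filtration n =
     (if n < 0 then {0} else if n = 0 then range (Poly_Mapping.single 0) else UNIV)"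

definition cscale :: "('g::{finite,ab_group_add} group_alg \<Rightarrow> 'v::ab_group_add \<Rightarrow> 'v) \<Rightarrow> complex \<Rightarrow> 'v \<Rightarrow> 'v" where
  "cscale smul c v = smul (Poly_Mapping.single 0 c) v"

definition gact :: "('g::{finite,ab_group_add} group_alg \<Rightarrow> 'v::ab_group_add \<Rightarrow> 'v) \<Rightarrow> 'g \<Rightarrow> 'v \<Rightarrow> 'v" where
  "gact smul g v = smul (Poly_Mapping.single g 1) v"

definition fin_dim_subspace :: "('g::{finite,ab_group_add} group_alg \<Rightarrow> 'v::ab_group_add \<Rightarrow> 'v) \<Rightarrow> 'v set \<Rightarrow> bool" where
  "fin_dim_subspace smul W \<longleftrightarrow>
     module.subspace (cscale smul) W \<and> (\<exists>B. finite B \<and> W = module.span (cscale smul) B)"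

text \<open>
  The filtration condition $F_i M_j \subseteq M_{j-i}$ has content only for $i = j = 1$,
  where it says that the group algebra maps $M_1$ into $M_0$: for $i = 0$ it is closure under
  scalars, and for $j \ge 2$ the space $M_j$ vanishes.
\<close>

definition glider_el1 :: "('g::{finite,ab_group_add} group_alg \<Rightarrow> 'v::ab_group_add \<Rightarrow> 'v) \<Rightarrow> (nat \<Rightarrow> 'v set) \<Rightarrow> bool" where
  "glider_el1 smul M \<longleftrightarrow>
     module smul \<and>
     (\<forall>i. fin_dim_subspace smul (M i)) \<and>
     (\<forall>i. M (Suc i) \<subseteq> M i) \<and>
     (\<forall>i j. i \<le> j \<longrightarrow> (\<forall>a \<in> group_alg_filtration (int i). \<forall>m \<in> M j. smul a m \<in> M (j - i))) \<and>
     M 1 \<noteq> {0} \<and>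
     (\<forall>i\<ge>2. M i = {0})"

definition irreducible_glider :: "('g::{finite,ab_group_add} group_alg \<Rightarrow> 'v::ab_group_add \<Rightarrow> 'v) \<Rightarrow> (nat \<Rightarrow> 'v set) \<Rightarrow> bool" where
  "irreducible_glider smul M \<longleftrightarrow>
     vector_space.dim (cscale smul) (M 1) = 1 \<and> M 0 = module.span smul (M 1)"

text \<open>
  The trace of a complex-linear map \<open>f\<close> of a finite-dimensional subspace \<open>W\<close> into itself,
  computed in an arbitrary basis of \<open>W\<close>.
\<close>

definition trace_on :: "(complex \<Rightarrow> 'v::ab_group_add \<Rightarrow> 'v) \<Rightarrow> 'v set \<Rightarrow> ('v \<Rightarrow> 'v) \<Rightarrow> complex" where
  "trace_on sc W f =
     (let B = (SOME B. \<not> module.dependent sc B \<and> module.span sc B = W)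
      in \<Sum>b\<in>B. module.representation sc B (f b) b)"

text \<open>
  Here \<open>W\<close> need only be stable under the subgroup whose character is meant, and the value is
  used only on that subgroup. For the trivial subgroup, \<open>W\<close> is any finite-dimensional
  subspace and the value at \<open>0\<close> is its dimension; see \<open>rep_character_zero\<close> below.
\<close>

definition rep_character :: "('g::{finite,ab_group_add} group_alg \<Rightarrow> 'v::ab_group_add \<Rightarrow> 'v) \<Rightarrow> 'v set \<Rightarrow> 'g \<Rightarrow> complex" where
  "rep_character smul W g = trace_on (cscale smul) W (gact smul g)"

record 'g gen_class_fun =
  comp00 :: "'g \<Rightarrow> complex"
  comp01 :: "'g \<Rightarrow> complex"
  comp11 :: "'g \<Rightarrow> complex"

definition gen_trace :: "('g::{finite,ab_group_add} group_alg \<Rightarrow> 'v::ab_group_add \<Rightarrow> 'v) \<Rightarrow> (nat \<Rightarrow> 'v set) \<Rightarrow> 'g gen_class_fun" where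
  "gen_trace smul M =
     \<lparr> comp00 = rep_character smul (M 0),
       comp01 = rep_character smul (M 1),
       comp11 = rep_character smul (module.span smul (M 1)) \<rparr>"

definition class_inprod :: "'g::{finite,ab_group_add} set \<Rightarrow> ('g \<Rightarrow> complex) \<Rightarrow> ('g \<Rightarrow> complex) \<Rightarrow> complex" where
  "class_inprod \<Gamma> f g = (\<Sum>x\<in>\<Gamma>. f x * g (- x)) / of_nat (card \<Gamma>)"

definition gen_inprod :: "'g::{finite,ab_group_add} gen_class_fun \<Rightarrow> 'g gen_class_fun \<Rightarrow> complex^2^2" where
  "gen_inprod f g = vector
     [vector [class_inprod {0} (comp00 f) (comp00 g), class_inprod {0} (comp01 f) (comp01 g)],
      vector [0, class_inprod UNIV (comp11 f) (comp11 g)]]"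

lemma vector_space_cscale:
  assumes "module smul"
  shows "vector_space (cscale smul)"
proof -
  interpret module smul by fact
  show ?thesis
    by unfold_locales
      (simp_all add: cscale_def scale_right_distrib single_add scale_left_distrib mult_single)
qed

lemma rep_character_zero:
  assumes "module smul" and "fin_dim_subspace smul W"
  shows "rep_character smul W 0 = of_nat (vector_space.dim (cscale smul) W)"
proof -
  interpret vector_space "cscale smul" by (rule vector_space_cscale) fact
  define B where "B = (SOME B. independent B \<and> span B = W)"
  have "subspace W"
    using assms(2) unfolding fin_dim_subspace_def by (rule conjunct1)
  obtain C where C: "C \<subseteq> W" "independent C" "W \<subseteq> span C"
    by (rule basis_exists)
  then have "span C = W"
    using span_minimal[OF C(1) \<open>subspace W\<close>] by (intro subset_antisym)
  with C(2) have "\<exists>B. independent B \<and> span B = W" by blast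
  then have B: "independent B \<and> span B = W"
    unfolding B_def by (rule someI_ex)
  have "gact smul 0 v = v" for v
    using module.scale_one[OF assms(1)] by (simp add: gact_def)
  moreover have "representation B b b = 1" if "b \<in> B" for b
    using that B by (simp add: representation_basis)
  ultimately have "rep_character smul W 0 = of_nat (card B)"
    by (simp add: rep_character_def trace_on_def Let_def flip: B_def)
  then show ?thesis
    using dim_span_eq_card_independent[of B] B by simp
qed

end

theory Submission
  imports Defs
begin

text \<open>
  The heart of the matter is that a cyclic module \<open>W\<close> generated by \<open>v\<close> satisfies
  \<open>\<langle>\<chi>\<^sub>W, \<chi>\<^sub>W\<rangle> = dim W\<close>: the element \<open>v\<close> is the sum of its
  components in the isotypic parts of the abelian group, the nonzero components form a basis of
  \<open>W\<close>, and so \<open>\<chi>\<^sub>W\<close> is a sum of \<open>dim W\<close> distinct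
  linear characters, which are orthonormal. If \<open>M\<^sub>1\<close> is a line, this applies to the
  module generated by \<open>M\<^sub>1\<close>, and that module, being contained in \<open>M\<close>, equals
  \<open>M\<close> exactly when the dimensions agree.
\<close>

section \<open>Linear algebra: traces and dimensions\<close>

context vector_space
begin

text \<open>Both sides equal the double sum of (coefficient of \<open>c\<close> in \<open>b\<close>)
  times (coefficient of \<open>b\<close> in \<open>f c\<close>): expanding \<open>b\<close> in
  \<open>C\<close> gives it from the left, and re-expanding \<open>f c\<close> through
  \<open>B\<close> collapses it to the right.\<close>

lemma trace_basis_unique:
  assumes B: "independent B" "finite B" and C: "independent C" "finite C"
    and eq: "span B = span C"
    and add: "\<And>x y. f (x + y) = f x + f y" and hom: "\<And>c x. f (scale c x) = scale c (f x)"
    and into: "\<And>x. x \<in> span B \<Longrightarrow> f x \<in> span B"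
  shows "(\<Sum>b\<in>B. representation B (f b) b) = (\<Sum>c\<in>C. representation C (f c) c)"
proof -
  have f0: "f 0 = 0"
    using hom[of 0 0] by simp
  have f_sum: "f (sum h A) = (\<Sum>a\<in>A. f (h a))" for h :: "'b \<Rightarrow> 'b" and A
    by (induction A rule: infinite_finite_induct) (simp_all add: f0 add)
  have fC: "f c \<in> span B" if "c \<in> C" for c
    using into that span_base eq by blast
  have "representation B (f b) b = (\<Sum>c\<in>C. representation C b c * representation B (f c) b)"
    if "b \<in> B" for b
  proof -
    have "b \<in> span C"
      using span_base that eq by blast
    then have "(\<Sum>c\<in>C. scale (representation C b c) c) = b"
      using C by (intro sum_representation_eq) auto
    then have "f b = (\<Sum>c\<in>C. scale (representation C b c) (f c))"
      using f_sum[of "\<lambda>c. scale (representation C b c) c" C] by (simp add: hom)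
    then show ?thesis
      using B(1) fC by (simp add: representation_sum representation_scale span_scale)
  qed
  then have "(\<Sum>b\<in>B. representation B (f b) b)
      = (\<Sum>b\<in>B. \<Sum>c\<in>C. representation C b c * representation B (f c) b)"
    by simp
  also have "\<dots> = (\<Sum>c\<in>C. \<Sum>b\<in>B. representation B (f c) b * representation C b c)"
    by (subst sum.swap) (simp add: mult.commute)
  also have "\<dots> = (\<Sum>c\<in>C. representation C (f c) c)"
  proof (rule sum.cong[OF refl])
    fix c assume "c \<in> C"
    then have "(\<Sum>b\<in>B. scale (representation B (f c) b) b) = f c"
      using B fC by (intro sum_representation_eq) auto
    moreover have "b \<in> span C" if "b \<in> B" for b
      using span_base that eq by blast
    ultimately show "(\<Sum>b\<in>B. representation B (f c) b * representation C b c)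
        = representation C (f c) c"
      using C(1) representation_sum[OF C(1), of B "\<lambda>b. scale (representation B (f c) b) b"]
      by (simp add: representation_scale span_scale)
  qed
  finally show ?thesis .
qed

text \<open>A basis of \<open>U\<close> extends to one of \<open>W\<close> of the same finite size,
  so nothing was added. The finite set \<open>D\<close> excludes infinite bases, for which
  \<open>dim\<close> takes the default value 0.\<close>

lemma subspace_dim_eq_imp_eq:
  assumes "subspace U" "subspace W" "U \<subseteq> W" "finite D" "W \<subseteq> span D" "dim U = dim W"
  shows "U = W"
proof -
  obtain B where B: "B \<subseteq> U" "independent B" "U \<subseteq> span B" "card B = dim U"
    by (rule basis_exists)
  obtain C where C: "B \<subseteq> C" "C \<subseteq> W" "independent C" "W \<subseteq> span C"
    using maximal_independent_subset_extend[OF _ B(2), of W] B(1) assms(3) by blast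
  have "finite C"
    using independent_span_bound[OF assms(4) C(3)] C(2) assms(5) by blast
  moreover have "card C = dim W"
    using basis_card_eq_dim[OF C(2,4,3)] by simp
  ultimately have "B = C"
    using card_subset_eq[OF _ C(1)] B(4) assms(6) by simp
  then show ?thesis
    using span_minimal[OF B(1) assms(1)] C(4) assms(3) by blast
qed

end

text \<open>Removes the arbitrary choice of basis in \<open>trace_on\<close>, so that characters can
  later be read off a basis of eigenvectors.\<close>

lemma trace_on_eq:
  assumes "vector_space sc"
    and "\<not> module.dependent sc B" "finite B" "module.span sc B = W"
    and "\<And>x y. f (x + y) = f x + f y" "\<And>c x. f (sc c x) = sc c (f x)"
    and "\<And>x. x \<in> W \<Longrightarrow> f x \<in> W"
  shows "trace_on sc W f = (\<Sum>b\<in>B. module.representation sc B (f b) b)"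
proof -
  interpret vector_space sc by fact
  define C where "C = (SOME C. independent C \<and> span C = W)"
  have C: "independent C \<and> span C = W"
    unfolding C_def by (rule someI[of _ B]) (use assms in blast)
  then have "finite C"
    using independent_span_bound[OF assms(3), of C] assms(4) span_superset by blast
  then show ?thesis
    using trace_basis_unique[of C B f] C assms
    unfolding trace_on_def Let_def C_def[symmetric] by blast
qed

section \<open>Linear characters of a finite abelian group\<close>

definition characters :: "('g::ab_group_add \<Rightarrow> complex) set" where
  "characters = {\<phi>. \<phi> 0 = 1 \<and> (\<forall>g h. \<phi> (g + h) = \<phi> g * \<phi> h)}"

lemma character_zero: "\<phi> \<in> characters \<Longrightarrow> \<phi> 0 = 1"
  and character_add: "\<phi> \<in> characters \<Longrightarrow> \<phi> (g + h) = \<phi> g * \<phi> h"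
  by (simp_all add: characters_def)

lemma character_mult_uminus:
  assumes "\<phi> \<in> characters"
  shows "\<phi> g * \<phi> (- g) = 1"
  using character_add[OF assms, of g "- g"] character_zero[OF assms] by simp

lemma sum_translate:
  fixes f :: "'g::{finite,ab_group_add} \<Rightarrow> 'b::comm_monoid_add"
  shows "(\<Sum>x\<in>UNIV. f (h + x)) = (\<Sum>x\<in>UNIV. f x)"
  by (rule sum.reindex_bij_witness[of _ "\<lambda>x. x - h" "\<lambda>x. h + x"]) auto

lemma prod_translate:
  fixes f :: "'g::{finite,ab_group_add} \<Rightarrow> 'b::comm_monoid_mult"
  shows "(\<Prod>x\<in>UNIV. f (h + x)) = (\<Prod>x\<in>UNIV. f x)"
  by (rule prod.reindex_bij_witness[of _ "\<lambda>x. x - h" "\<lambda>x. h + x"]) auto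

text \<open>All values are roots of unity of order dividing \<open>CARD('g)\<close>: translation by
  \<open>g\<close> fixes the nonzero product of all values of \<open>\<phi>\<close> and also
  multiplies it by \<open>\<phi> g ^ CARD('g)\<close>.\<close>

lemma finite_characters: "finite (characters :: ('g::{finite,ab_group_add} \<Rightarrow> complex) set)"
proof (rule finite_subset)
  let ?R = "{z :: complex. z ^ CARD('g) = 1}"
  show "characters \<subseteq> (\<Pi>\<^sub>E g\<in>(UNIV::'g set). ?R)"
  proof
    fix \<phi> :: "'g \<Rightarrow> complex" assume \<phi>: "\<phi> \<in> characters"
    have "\<phi> g ^ CARD('g) = 1" for g
    proof -
      have "(\<Prod>x\<in>UNIV. \<phi> x) \<noteq> 0"
        using character_mult_uminus[OF \<phi>] by (simp, metis mult_zero_left zero_neq_one)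
      moreover have "(\<Prod>x\<in>UNIV. \<phi> x) = \<phi> g ^ CARD('g) * (\<Prod>x\<in>UNIV. \<phi> x)"
        using prod_translate[of \<phi> g] by (simp add: character_add[OF \<phi>] prod.distrib)
      ultimately show ?thesis by simp
    qed
    then show "\<phi> \<in> (\<Pi>\<^sub>E g\<in>UNIV. ?R)" by (simp add: PiE_UNIV_domain)
  qed
  show "finite (\<Pi>\<^sub>E g\<in>(UNIV::'g set). ?R)"
    by (intro finite_PiE) (auto intro!: finite_nth_roots)
qed

text \<open>If \<open>\<phi> h \<noteq> \<psi> h\<close>, translating the summation by
  \<open>h\<close> multiplies the sum by \<open>\<phi> h * \<psi> (- h)\<close>, which is not 1;
  hence the sum vanishes.\<close>

lemma character_orthogonality:
  fixes \<phi> \<psi> :: "'g::{finite,ab_group_add} \<Rightarrow> complex"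
  assumes \<phi>: "\<phi> \<in> characters" and \<psi>: "\<psi> \<in> characters"
  shows "(\<Sum>g\<in>UNIV. \<phi> g * \<psi> (- g)) = (if \<phi> = \<psi> then of_nat CARD('g) else 0)"
proof (cases "\<phi> = \<psi>")
  case True
  then show ?thesis by (simp add: character_mult_uminus[OF \<psi>])
next
  case False
  then obtain h where h: "\<phi> h \<noteq> \<psi> h" by blast
  let ?S = "\<Sum>g\<in>UNIV. \<phi> g * \<psi> (- g)"
  have "\<psi> (- (h + g)) = \<psi> (- h) * \<psi> (- g)" for g
    using character_add[OF \<psi>, of "- h" "- g"] by simp
  then have "?S = \<phi> h * \<psi> (- h) * ?S"
    using sum_translate[of "\<lambda>g. \<phi> g * \<psi> (- g)" h]
    by (simp add: character_add[OF \<phi>] sum_distrib_left ac_simps del: minus_add_distrib)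
  then have "\<psi> h * ?S = \<psi> h * \<psi> (- h) * \<phi> h * ?S" by (simp add: ac_simps)
  then have "\<psi> h * ?S = \<phi> h * ?S"
    by (simp only: character_mult_uminus[OF \<psi>] mult_1)
  with h False show ?thesis by simp
qed

section \<open>Roots of unity and spectral idempotents in the group algebra\<close>

text \<open>
  Multiplication by \<open>g\<close> permutes the product of all group elements, which is invertible.
\<close>

lemma single_power_card:
  fixes g :: "'g::{finite,ab_group_add}"
  shows "Poly_Mapping.single g (1::complex) ^ CARD('g) = 1"
proof -
  let ?s = "\<lambda>g::'g. Poly_Mapping.single g (1::complex)"
  have "(\<Prod>x\<in>UNIV. ?s x) = ?s g ^ CARD('g) * (\<Prod>x\<in>UNIV. ?s x)"
  proof -
    have "(\<Prod>x\<in>UNIV. ?s x) = (\<Prod>x\<in>UNIV. ?s g * ?s x)"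
      using prod_translate[of ?s g] by (simp add: mult_single)
    then show ?thesis by (simp add: prod.distrib)
  qed
  then have "(\<Prod>x\<in>UNIV. ?s x * ?s (- x)) = ?s g ^ CARD('g) * (\<Prod>x\<in>UNIV. ?s x * ?s (- x))"
    by (simp only: prod.distrib mult.assoc[symmetric])
  then show ?thesis by (simp add: mult_single)
qed

lemma single_zero_mult_power:
  "(Poly_Mapping.single 0 c * a) ^ n = Poly_Mapping.single 0 (c ^ n) * a ^ n"
  for c :: complex and a :: "'g::ab_group_add group_alg"
proof -
  have "Poly_Mapping.single 0 c ^ n = Poly_Mapping.single (0::'g) (c ^ n)"
    by (induction n) (simp_all add: mult_single)
  then show ?thesis
    by (simp add: power_mult_distrib)
qed

lemma single_zero_sum:
  "Poly_Mapping.single 0 (sum f A) = (\<Sum>x\<in>A. Poly_Mapping.single 0 (f x :: complex))"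
  by (induction A rule: infinite_finite_induct) (simp_all add: single_add)

text \<open>For \<open>j > 0\<close> the ratio of this geometric sum is an \<open>N\<close>-th root
  of unity. It differs from 1, since \<open>j\<close> and \<open>0\<close> index distinct
  \<open>N\<close>-th roots, so the sum vanishes.\<close>

lemma sum_roots_of_unity_power:
  assumes "j < N"
  shows "(\<Sum>k<N. (cis (2 * pi / N) ^ j) ^ k) = (if j = 0 then of_nat N else 0)"
proof (cases "j = 0")
  case False
  let ?q = "cis (2 * pi / N) ^ j"
  have q: "?q = cis (2 * pi * real j / real N)"
    by (simp add: Complex.DeMoivre mult.commute)
  have "inj_on (\<lambda>k. cis (2 * pi * real k / real N)) {..<N}"
    using Complex.bij_betw_roots_unity[of N] assms by (auto simp: bij_betw_def)
  then have "?q \<noteq> 1"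
    using False assms q by (auto dest: inj_onD[of _ _ j 0])
  moreover have "?q ^ N = 1"
  proof -
    have "cis (2 * pi / N) ^ N = 1"
      using assms by (simp add: Complex.DeMoivre)
    then show ?thesis
      by (metis mult.commute power_mult power_one)
  qed
  ultimately have "(\<Sum>k<N. ?q ^ k) = 0"
    using power_diff_1_eq[of ?q N] by auto
  then show ?thesis using False by simp
qed simp

text \<open>Splits 1 into eigenvectors of multiplication by \<open>g\<close>. With
  \<open>\<omega>\<close> a primitive root of unity of order \<open>N = CARD('g)\<close>,
  \<open>e k\<close> is the average of the powers of \<open>\<omega> ^ k\<close> times
  \<open>g\<close>; its eigenvalue is the inverse of \<open>\<omega> ^ k\<close>. Taking the group
  order in place of the order of \<open>g\<close> treats all \<open>g\<close> alike.\<close>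

lemma cyclic_idempotents:
  fixes g :: "'g::{finite,ab_group_add}"
  obtains c :: "nat \<Rightarrow> complex" and e :: "nat \<Rightarrow> 'g group_alg"
  where "\<And>k. Poly_Mapping.single g 1 * e k = Poly_Mapping.single 0 (c k) * e k"
    and "(\<Sum>k<CARD('g). e k) = 1"
proof
  define N where "N = CARD('g)"
  define \<omega> where "\<omega> = cis (2 * pi / N)"
  define a where "a = Poly_Mapping.single g (1::complex)"
  define s where "s = (Poly_Mapping.single 0 :: complex \<Rightarrow> 'g group_alg)"
  have s_mult: "s x * s y = s (x * y)" for x y
    by (simp add: s_def mult_single)
  define e where "e = (\<lambda>k. s (1 / N) * (\<Sum>j<N. (s (\<omega> ^ k) * a) ^ j))"
  have "N > 0"
    by (simp add: N_def)
  then have \<omega>N: "\<omega> ^ N = 1"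
    by (simp add: \<omega>_def Complex.DeMoivre)
  have aN: "a ^ N = 1"
    by (simp add: a_def N_def single_power_card)
  show "Poly_Mapping.single g 1 * e k = Poly_Mapping.single 0 (inverse (\<omega> ^ k)) * e k" for k
  proof -
    let ?b = "s (\<omega> ^ k) * a"
    have "(\<omega> ^ k) ^ N = 1"
      by (metis \<omega>N mult.commute power_mult power_one)
    then have "?b ^ N = 1"
      unfolding s_def single_zero_mult_power aN by simp
    then have "(?b - 1) * (\<Sum>j<N. ?b ^ j) = 0"
      using power_diff_1_eq[of ?b N] by simp
    then have b: "?b * e k = e k"
      by (simp add: e_def algebra_simps)
    \<comment> \<open>Inserting \<open>inverse (\<omega> ^ k) * \<omega> ^ k = 1\<close> exposes the
      factor \<open>?b\<close>, which \<open>e k\<close> absorbs.\<close>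
    have "a * e k = s (inverse (\<omega> ^ k) * \<omega> ^ k) * (a * e k)"
      by (simp add: \<omega>_def s_def)
    also have "\<dots> = s (inverse (\<omega> ^ k)) * (?b * e k)"
      by (simp only: s_mult[symmetric] mult.assoc)
    finally show ?thesis
      by (simp only: b, simp only: s_def a_def)
  qed
  have "(\<Sum>k<N. e k) = s (1 / N) * (\<Sum>k<N. \<Sum>j<N. s ((\<omega> ^ k) ^ j) * a ^ j)"
    by (simp add: e_def sum_distrib_left s_def single_zero_mult_power)
  \<comment> \<open>With the summations exchanged, the inner sum over \<open>k\<close> kills every
    power of \<open>a\<close> except the zeroth.\<close>
  also have "(\<Sum>k<N. \<Sum>j<N. s ((\<omega> ^ k) ^ j) * a ^ j) = (\<Sum>j<N. s (\<Sum>k<N. (\<omega> ^ j) ^ k) * a ^ j)"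
    by (subst sum.swap)
      (simp add: s_def single_zero_sum sum_distrib_right sum_distrib_left mult.commute flip: power_mult)
  also have "\<dots> = (\<Sum>j<N. if j = 0 then s N else 0)"
    by (intro sum.cong refl) (simp add: \<omega>_def sum_roots_of_unity_power s_def)
  also have "s (1 / N) * \<dots> = 1"
    using \<open>N > 0\<close> by (simp add: sum.delta s_mult) (simp add: s_def)
  finally show "(\<Sum>k<CARD('g). e k) = 1"
    by (simp add: N_def)
qed

section \<open>Modules over the group algebra and their eigenvectors\<close>

locale group_algebra_module = module smul
  for smul :: "('g::{finite,ab_group_add}) group_alg \<Rightarrow> 'v::ab_group_add \<Rightarrow> 'v"
begin

text \<open>Two linear structures coexist from here on: unprefixed \<open>span\<close> and
  \<open>subspace\<close> refer to the group algebra, those prefixed by \<open>C\<close> to the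
  complex numbers.\<close>

sublocale C: vector_space "cscale smul"
  by (rule vector_space_cscale) unfold_locales

abbreviation "sc \<equiv> cscale smul"
abbreviation "act \<equiv> gact smul"

lemma act_add: "act g (v + w) = act g v + act g w"
  by (simp add: gact_def scale_right_distrib)

lemma act_sc: "act g (sc c v) = sc c (act g v)"
  by (simp add: gact_def cscale_def mult_single)

lemma act_act: "act g (act h v) = act (g + h) v"
  by (simp add: gact_def mult_single)

lemma act_sum: "act g (sum f A) = (\<Sum>x\<in>A. act g (f x))"
  by (simp add: gact_def scale_sum_right)

lemma act_zero: "act 0 v = v"
  by (simp add: gact_def)

lemma smul_sc: "smul a (sc c v) = sc c (smul a v)"
  by (simp add: cscale_def mult.commute)

lemma smul_act: "smul a (act g v) = act g (smul a v)"
  by (simp add: gact_def mult.commute)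



text \<open>Simultaneous diagonalization, one group element at a time. The elements
  \<open>e k\<close> for the new \<open>g\<close> split each vector \<open>w\<close> into
  eigenvectors of \<open>g\<close>; as the group algebra is commutative, each part keeps the
  eigenvalues of \<open>w\<close> on \<open>S\<close>.\<close>

lemma span_eigenvectors:
  fixes S :: "'g set"
  assumes "finite S"
  shows "v \<in> C.span {w. \<forall>g\<in>S. \<exists>c. act g w = sc c w}"
  using assms
proof (induction S arbitrary: v)
  case empty
  then show ?case by (simp add: C.span_base)
next
  case (insert g S)
  let ?E = "\<lambda>S. {w. \<forall>g\<in>S. \<exists>c. act g w = sc c w}"
  have "?E S \<subseteq> C.span (?E (insert g S))"
  proof
    fix w assume w: "w \<in> ?E S"
    obtain c and e :: "nat \<Rightarrow> 'g group_alg"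
      where e: "\<And>k. Poly_Mapping.single g 1 * e k = Poly_Mapping.single 0 (c k) * e k"
        "(\<Sum>k<CARD('g). e k) = 1"
      using cyclic_idempotents[of g] by blast
    have "smul (e k) w \<in> ?E (insert g S)" for k
    proof -
      have "act g (smul (e k) w) = sc (c k) (smul (e k) w)"
        by (simp add: gact_def cscale_def e(1))
      moreover have "\<exists>c. act h (smul (e k) w) = sc c (smul (e k) w)" if "h \<in> S" for h
        using w that by (auto simp: smul_act[symmetric] smul_sc)
      ultimately show ?thesis by auto
    qed
    then have "(\<Sum>k<CARD('g). smul (e k) w) \<in> C.span (?E (insert g S))"
      by (intro C.span_sum C.span_base)
    moreover have "(\<Sum>k<CARD('g). smul (e k) w) = w"
      using scale_sum_left[of e "{..<CARD('g)}" w] by (simp only: e(2) scale_one)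
    ultimately show "w \<in> C.span (?E (insert g S))"
      by (simp only:)
  qed
  then have "C.span (?E S) \<subseteq> C.span (?E (insert g S))"
    by (rule C.span_minimal[OF _ C.subspace_span])
  then show ?case
    using insert.IH[of v] by (rule subsetD)
qed

section \<open>Isotypic projections\<close>

text \<open>The usual projection onto the \<open>\<phi>\<close>-isotypic part, with
  \<open>\<phi> (- g)\<close> in the role of the complex conjugate of
  \<open>\<phi> g\<close>.\<close>

definition proj :: "('g \<Rightarrow> complex) \<Rightarrow> 'v \<Rightarrow> 'v" where
  "proj \<phi> v = (\<Sum>g\<in>UNIV. sc (\<phi> (- g) / of_nat CARD('g)) (act g v))"

lemma proj_add: "proj \<phi> (v + w) = proj \<phi> v + proj \<phi> w"
  by (simp add: proj_def act_add C.scale_right_distrib sum.distrib)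

lemma proj_sc: "proj \<phi> (sc c v) = sc c (proj \<phi> v)"
  by (simp add: proj_def act_sc C.scale_sum_right mult.commute)

lemma proj_zero: "proj \<phi> 0 = 0"
  using proj_sc[of \<phi> 0 0] by simp

lemma subspace_proj_zero: "C.subspace {w. proj \<phi> w = 0}"
  by (simp add: C.subspace_def proj_zero proj_add proj_sc)

lemma act_proj:
  assumes "\<phi> \<in> characters"
  shows "act h (proj \<phi> v) = sc (\<phi> h) (proj \<phi> v)"
proof -
  have "\<phi> (- g) = \<phi> h * \<phi> (- (h + g))" for g
    using character_add[OF assms, of h "- (h + g)"] by simp
  then have "act h (proj \<phi> v) = (\<Sum>g\<in>UNIV. sc (\<phi> h * \<phi> (- (h + g)) / of_nat CARD('g)) (act (h + g) v))"
    unfolding proj_def act_sum act_sc act_act by metis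
  also have "\<dots> = (\<Sum>g\<in>UNIV. sc (\<phi> h * \<phi> (- g) / of_nat CARD('g)) (act g v))"
    by (rule sum_translate)
  finally show ?thesis
    by (simp add: proj_def C.scale_sum_right)
qed

lemma proj_eigenvector:
  assumes "\<phi> \<in> characters" "\<psi> \<in> characters" and "\<And>g. act g w = sc (\<phi> g) w"
  shows "proj \<psi> w = (if \<psi> = \<phi> then w else 0)"
proof -
  have "proj \<psi> w = sc ((\<Sum>g\<in>UNIV. \<phi> g * \<psi> (- g)) / of_nat CARD('g)) w"
    by (simp add: proj_def assms(3) C.scale_sum_left sum_divide_distrib mult.commute)
  then show ?thesis
    by (simp add: character_orthogonality[OF assms(1,2)])
qed

lemma proj_proj:
  assumes "\<phi> \<in> characters" "\<psi> \<in> characters"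
  shows "proj \<psi> (proj \<phi> v) = (if \<psi> = \<phi> then proj \<phi> v else 0)"
  by (rule proj_eigenvector[OF assms act_proj[OF assms(1)]])

text \<open>Both sides are linear in \<open>v\<close>, so it suffices to test simultaneous
  eigenvectors, which span. The eigenvalues of a nonzero one form a character, and only the
  projection for that character survives. No count of the characters enters.\<close>

lemma sum_proj: "(\<Sum>\<phi>\<in>characters. proj \<phi> v) = v"
proof -
  let ?F = "{w. (\<Sum>\<phi>\<in>characters. proj \<phi> w) = w}"
  have "C.subspace ?F"
    by (simp add: C.subspace_def proj_zero proj_add proj_sc sum.distrib flip: C.scale_sum_right)
  moreover have "{w. \<forall>g\<in>UNIV. \<exists>c. act g w = sc c w} \<subseteq> ?F"
  proof
    fix w assume "w \<in> {w. \<forall>g\<in>UNIV. \<exists>c. act g w = sc c w}"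
    then obtain \<phi> where \<phi>: "\<And>g. act g w = sc (\<phi> g) w"
      by simp metis
    show "w \<in> ?F"
    proof (cases "w = 0")
      case False
      have "sc (\<phi> 0) w = sc 1 w"
        using \<phi>[of 0] by (simp add: act_zero)
      moreover have "sc (\<phi> (g + h)) w = sc (\<phi> g * \<phi> h) w" for g h
        using act_act[of g h w] by (simp add: \<phi> act_sc mult.commute del: C.scale_cancel_right)
      ultimately have "\<phi> \<in> characters"
        unfolding characters_def using C.scale_right_imp_eq[OF False] by blast
      then show ?thesis
        by (simp add: proj_eigenvector[OF _ _ \<phi>] finite_characters)
    qed (simp add: proj_zero)
  qed
  ultimately show ?thesis
    using span_eigenvectors[of UNIV v] C.span_minimal[of "{w. \<forall>g\<in>UNIV. \<exists>c. act g w = sc c w}" ?F]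
    by auto
qed

section \<open>Cyclic modules: dimension and norm of the character\<close>

lemma smul_in_span_orbit: "smul a v \<in> C.span (range (\<lambda>g. act g v))"
proof -
  have "a = (\<Sum>g\<in>UNIV. Poly_Mapping.single g (Poly_Mapping.lookup a g))"
    by (rule poly_mapping_eqI) (simp add: lookup_sum lookup_single when_def)
  also have "smul \<dots> v = (\<Sum>g\<in>UNIV. sc (Poly_Mapping.lookup a g) (act g v))"
    by (simp add: scale_sum_left cscale_def gact_def mult_single)
  also have "\<dots> \<in> C.span (range (\<lambda>g. act g v))"
    by (intro C.span_sum C.span_scale C.span_base) simp
  finally show ?thesis .
qed

lemma complex_subspace_span: "C.subspace (span X)"
  by (simp add: C.subspace_def span_zero span_add cscale_def span_scale)

lemma act_in_span: "w \<in> span X \<Longrightarrow> act g w \<in> span X"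
  by (simp add: gact_def span_scale)

text \<open>Exhibits a cyclic module as the complex span of a finite orbit; this bounds its
  dimension and supplies the finite spanning set for comparing dimensions.\<close>

lemma span_singleton_orbit: "span {v} = C.span (range (\<lambda>g. act g v))"
proof
  show "span {v} \<subseteq> C.span (range (\<lambda>g. act g v))"
    by (auto simp: span_singleton smul_in_span_orbit)
  show "C.span (range (\<lambda>g. act g v)) \<subseteq> span {v}"
    by (intro C.span_minimal complex_subspace_span) (auto intro: act_in_span span_base)
qed

lemma dim_cyclic_le: "C.dim (span {v}) \<le> CARD('g)"
proof -
  have "C.dim (span {v}) \<le> card (range (\<lambda>g. act g v))"
    by (rule C.dim_le_card) (simp_all add: span_singleton_orbit)
  also have "\<dots> \<le> CARD('g)"
    by (rule card_image_le) simp
  finally show ?thesis .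
qed

lemma cyclic_norm_eq_dim:
  fixes v :: 'v
  defines "W \<equiv> span {v}"
  shows "class_inprod UNIV (rep_character smul W) (rep_character smul W) = of_nat (C.dim W)"
proof -
  \<comment> \<open>\<open>X\<close> collects the characters that occur in \<open>v\<close>; the
    components of \<open>v\<close> at these form the basis \<open>B\<close>.\<close>
  define X where "X = {\<phi> \<in> characters. proj \<phi> v \<noteq> 0}"
  define B where "B = (\<lambda>\<phi>. proj \<phi> v) ` X"
  have X: "finite X" "X \<subseteq> characters"
    by (auto simp: X_def finite_characters)
  have inj: "inj_on (\<lambda>\<phi>. proj \<phi> v) X"
  proof (rule inj_onI)
    fix \<phi> \<psi> assume *: "\<phi> \<in> X" "\<psi> \<in> X" "proj \<phi> v = proj \<psi> v"
    then have "proj \<phi> (proj \<psi> v) = proj \<phi> v" "proj \<phi> v \<noteq> 0"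
      using proj_proj[of \<phi> \<phi> v] by (auto simp: X_def)
    then show "\<phi> = \<psi>"
      using * proj_proj[of \<psi> \<phi> v] by (auto simp: X_def split: if_splits)
  qed
  have B: "finite B" "C.independent B" "C.span B = W"
  proof -
    show "finite B"
      using X by (simp add: B_def)
    show "C.independent B"
      unfolding C.dependent_def
    proof
      assume "\<exists>b\<in>B. b \<in> C.span (B - {b})"
      then obtain \<phi> where \<phi>: "\<phi> \<in> X" "proj \<phi> v \<in> C.span (B - {proj \<phi> v})"
        by (auto simp: B_def)
      \<comment> \<open>\<open>proj \<phi>\<close> kills all other members of \<open>B\<close> but
        fixes \<open>proj \<phi> v\<close>, so the latter cannot lie in their span.\<close>
      have "B - {proj \<phi> v} \<subseteq> {w. proj \<phi> w = 0}"
        using \<phi>(1) X(2) by (auto simp: B_def proj_proj subset_iff)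
      then have "proj \<phi> (proj \<phi> v) = 0"
        using C.span_minimal[OF _ subspace_proj_zero] \<phi>(2) by blast
      then show False
        using \<phi>(1) by (auto simp: X_def proj_proj)
    qed
    show "C.span B = W"
    proof
      have "proj \<phi> v \<in> W" for \<phi>
        unfolding proj_def W_def
        by (intro C.subspace_sum C.subspace_scale complex_subspace_span act_in_span span_base) simp
      then show "C.span B \<subseteq> W"
        unfolding W_def by (intro C.span_minimal complex_subspace_span) (auto simp: B_def)
      have "act g v \<in> C.span B" for g
      proof -
        have "act g v = (\<Sum>\<phi>\<in>characters. sc (\<phi> g) (proj \<phi> v))"
          using act_sum[of g "\<lambda>\<phi>. proj \<phi> v" characters] by (simp add: sum_proj act_proj)
        also have "\<dots> = (\<Sum>\<phi>\<in>X. sc (\<phi> g) (proj \<phi> v))"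
          by (rule sum.mono_neutral_right) (auto simp: X_def finite_characters)
        also have "\<dots> \<in> C.span B"
          by (intro C.span_sum C.span_scale C.span_base) (simp add: B_def)
        finally show ?thesis .
      qed
      then show "W \<subseteq> C.span B"
        unfolding W_def span_singleton_orbit
        by (intro C.span_minimal C.subspace_span) auto
    qed
  qed
  have dim: "C.dim W = card X"
    using C.dim_span_eq_card_independent[OF B(2)] card_image[OF inj] by (simp add: B(3)) (simp add: B_def)
  have trace: "rep_character smul W g = (\<Sum>\<phi>\<in>X. \<phi> g)" for g
  proof -
    have "rep_character smul W g = (\<Sum>b\<in>B. C.representation B (act g b) b)"
      unfolding rep_character_def
      by (rule trace_on_eq[OF C.vector_space_axioms]) (use B in \<open>auto simp: act_add act_sc W_def act_in_span\<close>)
    also have "\<dots> = (\<Sum>\<phi>\<in>X. C.representation B (act g (proj \<phi> v)) (proj \<phi> v))"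
      using inj by (simp add: B_def sum.reindex)
    \<comment> \<open>\<open>B\<close> consists of eigenvectors, so the diagonal entries are the
      eigenvalues.\<close>
    also have "\<dots> = (\<Sum>\<phi>\<in>X. \<phi> g)"
    proof (rule sum.cong[OF refl])
      fix \<phi> assume "\<phi> \<in> X"
      then have "proj \<phi> v \<in> B" "\<phi> \<in> characters"
        by (auto simp: B_def X_def)
      then show "C.representation B (act g (proj \<phi> v)) (proj \<phi> v) = \<phi> g"
        using B(2) by (simp add: act_proj C.representation_scale C.span_base C.representation_basis)
    qed
    finally show ?thesis .
  qed
  have "(\<Sum>g\<in>UNIV. (\<Sum>\<phi>\<in>X. \<phi> g) * (\<Sum>\<psi>\<in>X. \<psi> (- g)))
      = (\<Sum>\<phi>\<in>X. \<Sum>\<psi>\<in>X. \<Sum>g\<in>UNIV. \<phi> g * \<psi> (- g))"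
    unfolding sum_product by (subst sum.swap, subst sum.swap[of _ UNIV]) (rule refl)
  also have "\<dots> = (\<Sum>\<phi>\<in>X. \<Sum>\<psi>\<in>X. if \<phi> = \<psi> then of_nat CARD('g) else 0)"
    using X(2) by (intro sum.cong refl character_orthogonality) auto
  also have "\<dots> = of_nat (card X) * of_nat CARD('g)"
    using X(1) by simp
  finally show ?thesis
    by (simp add: class_inprod_def trace dim)
qed

lemma dim_one_imp_span_singleton:
  assumes "C.subspace U" "C.dim U = 1"
  obtains v where "v \<noteq> 0" "v \<in> U" "U = C.span {v}"
proof -
  obtain B where B: "B \<subseteq> U" "C.independent B" "U \<subseteq> C.span B" "card B = C.dim U"
    by (rule C.basis_exists)
  then obtain v where v: "B = {v}"
    using assms(2) card_1_singletonE by metis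
  show thesis
  proof (rule that)
    show "v \<noteq> 0"
      using B(2) C.dependent_zero[of B] unfolding v by blast
    show "v \<in> U"
      using B(1) unfolding v by blast
    show "U = C.span {v}"
      using B(3) C.span_minimal[OF B(1) assms(1)] unfolding v by (rule subset_antisym)
  qed
qed

text \<open>Complex scalars act through the group algebra. This turns the module generated by a line
  into the cyclic module of any generator of the line.\<close>

lemma span_complex_span: "span (C.span X) = span X"
proof
  have "C.span X \<subseteq> span X"
    by (intro C.span_minimal complex_subspace_span) (auto intro: span_base)
  then show "span (C.span X) \<subseteq> span X"
    by (intro span_minimal subspace_span)
  show "span X \<subseteq> span (C.span X)"
    by (intro span_mono C.span_superset)
qed

end

section \<open>The criterion for gliders\<close>

lemma class_inprod_rep_character_zero:
  assumes "module smul" "fin_dim_subspace smul W"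
  shows "class_inprod {0} (rep_character smul W) (rep_character smul W)
    = of_nat ((vector_space.dim (cscale smul) W)\<^sup>2)"
  by (simp add: class_inprod_def rep_character_zero[OF assms] power2_eq_square)

lemma vector_2x2_eq_iff:
  "vector [vector [a, b], vector [c, d]] = (vector [vector [a', b'], vector [c', d']] :: 'a::zero^2^2)
    \<longleftrightarrow> a = a' \<and> b = b' \<and> c = c' \<and> d = d'"
  by (auto simp: vec_eq_iff forall_2)

theorem proposition4p2:
  fixes smul :: "('g::{finite,ab_group_add}) group_alg \<Rightarrow> 'v::ab_group_add \<Rightarrow> 'v"
    and M :: "nat \<Rightarrow> 'v set"
  assumes "glider_el1 smul M"
  shows "irreducible_glider smul M \<longleftrightarrow>
    (\<exists>n::nat. 0 < n \<and> n \<le> CARD('g) \<and>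
      gen_inprod (gen_trace smul M) (gen_trace smul M) =
        vector [vector [of_nat (n^2), 1], vector [0, of_nat n]])"
proof -
  have "module smul" and fin: "fin_dim_subspace smul (M i)"
    and filt: "\<lbrakk>i \<le> j; a \<in> group_alg_filtration (int i); m \<in> M j\<rbrakk> \<Longrightarrow> smul a m \<in> M (j - i)"
    for i j a m
    using assms unfolding glider_el1_def by (fast, fast, fast)
  interpret group_algebra_module smul
    by (rule group_algebra_module.intro) fact
  have sub: "C.subspace (M i)" for i
    using fin[of i] by (simp add: fin_dim_subspace_def)
  define W where "W = span (M 1)"
  let ?d0 = "C.dim (M 0)" and ?d1 = "C.dim (M 1)"
  let ?norm = "class_inprod UNIV (rep_character smul W) (rep_character smul W)"
  \<comment> \<open>The first row holds squares of dimensions; these are natural numbers, so the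
    squares determine them.\<close>
  have inprod_iff: "gen_inprod (gen_trace smul M) (gen_trace smul M) =
        vector [vector [of_nat (n^2), 1], vector [0, of_nat n]]
      \<longleftrightarrow> ?d0 = n \<and> ?d1 = 1 \<and> ?norm = of_nat n" for n
  proof -
    have "(of_nat (?d1\<^sup>2) :: complex) = 1 \<longleftrightarrow> ?d1 = 1"
      by (metis of_nat_1 of_nat_eq_iff power2_eq_iff_nonneg power_one zero_le)
    moreover have "(of_nat (?d0\<^sup>2) :: complex) = of_nat (n\<^sup>2) \<longleftrightarrow> ?d0 = n"
      by (simp only: of_nat_eq_iff power2_eq_iff_nonneg zero_le)
    ultimately show ?thesis
      by (simp only: gen_inprod_def gen_trace_def gen_class_fun.simps vector_2x2_eq_iff
          class_inprod_rep_character_zero[OF \<open>module smul\<close> fin] W_def simp_thms)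
  qed
  have cyclic: "?norm = of_nat (C.dim W) \<and> 0 < C.dim W \<and> C.dim W \<le> CARD('g) \<and> W \<subseteq> M 0"
    if d1: "?d1 = 1"
  proof -
    obtain v where v: "v \<noteq> 0" "v \<in> M 1" "M 1 = C.span {v}"
      using dim_one_imp_span_singleton[OF sub d1] by blast
    have W: "W = span {v}"
      unfolding W_def v(3) by (rule span_complex_span)
    have "C.dim {0} = 0"
      using C.dim_span_eq_card_independent[OF C.independent_empty] by simp
    \<comment> \<open>\<open>W\<close> lies in the complex span of a finite orbit, so dimension 0
      would force \<open>W\<close> to be zero, although it contains \<open>v\<close>.\<close>
    have "C.dim W \<noteq> 0"
    proof
      assume "C.dim W = 0"
      with \<open>C.dim {0} = 0\<close> have "{0} = W"
        by (intro C.subspace_dim_eq_imp_eq[of _ _ "range (\<lambda>g. act g v)"])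
          (auto simp: W span_zero complex_subspace_span span_singleton_orbit C.span_zero)
      then show False
        using v(1) span_base[of v "{v}"] by (auto simp: W)
    qed
    \<comment> \<open>The filtration condition at \<open>i = j = 1\<close>, where the filtration is
      already the whole group algebra.\<close>
    moreover have "W \<subseteq> M 0"
      unfolding W using v(2) filt[of 1 1] by (auto simp: span_singleton group_alg_filtration_def)
    ultimately show ?thesis
      using cyclic_norm_eq_dim[of v] dim_cyclic_le[of v] by (simp add: W)
  qed
  obtain D where D: "finite D" "M 0 = C.span D"
    using fin[of 0] by (auto simp: fin_dim_subspace_def)
  show ?thesis
  proof
    assume "irreducible_glider smul M"
    then have "?d1 = 1" "M 0 = W"
      by (simp_all add: irreducible_glider_def W_def)
    \<comment> \<open>The witness is the common dimension of \<open>M 0\<close> and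
      \<open>W\<close>.\<close>
    then show "\<exists>n. 0 < n \<and> n \<le> CARD('g) \<and>
      gen_inprod (gen_trace smul M) (gen_trace smul M) =
        vector [vector [of_nat (n^2), 1], vector [0, of_nat n]]"
      using cyclic unfolding inprod_iff by auto
  next
    assume "\<exists>n. 0 < n \<and> n \<le> CARD('g) \<and>
      gen_inprod (gen_trace smul M) (gen_trace smul M) =
        vector [vector [of_nat (n^2), 1], vector [0, of_nat n]]"
    then have d: "?d1 = 1" "?norm = of_nat ?d0"
      unfolding inprod_iff by auto
    \<comment> \<open>The norm equals \<open>C.dim W\<close> by \<open>cyclic\<close> and the
      dimension of \<open>M 0\<close> by the matrix.\<close>
    then have "C.dim W = ?d0" "W \<subseteq> M 0"
      using cyclic by auto
    then have "W = M 0"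
      using C.subspace_dim_eq_imp_eq[OF _ sub, of W 0 D] D complex_subspace_span W_def by auto
    then show "irreducible_glider smul M"
      using d(1) by (simp add: irreducible_glider_def W_def)
  qed
qed

end
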